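(* Let $m\ge 4$ be an integer with $m\equiv 1\pmod 3$, and let $1\le r<m$. Then $sp(m^2j+m+r,m)\equiv 0\pmod 3$ for all $j\ge 0$.
   Context: For fixed $m>1$, $sp(n,m)$ is defined by: $sp(n,m)=0$ for $n<0$, $sp(0,m)=1$, $sp(n,m)=1$ for $1\le n\le m-1$, and for $n\ge m$: $sp(n,m)=sp(n/m,m)$ if $m\mid n$, and $sp(n,m)=2sp(n-r,m)+sp(n-m,m)$ if $n\equiv r\pmod m$ with $0<r<m$. (It counts semi-$m$-Pell compositions of $n$.) *)

theory Defs
  imports "HOL-Number_Theory.Cong"
begin

text \<open>The number of semi-\<open>m\<close>-Pell compositions of \<open>n\<close>. The recurrence is only meant for \<open>m > 1\<close>;
  the value \<open>0\<close> for \<open>m \<le> 1\<close> is a dummy that makes the function total.\<close>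

function sp :: "int \<Rightarrow> int \<Rightarrow> nat" where
  "sp n m =
    (if m \<le> 1 then 0
     else if n < 0 then 0
     else if n < m then 1
     else if m dvd n then sp (n div m) m
     else 2 * sp (n - n mod m) m + sp (n - m) m)"
  by pat_completeness auto
termination
proof (relation "measure (\<lambda>(n, m). nat n)", goal_cases)
  case 1
  show ?case by simp
next
  case (2 n m)
  then have "n div m < n" by (intro int_div_less_self) auto
  with 2 show ?case by auto
next
  case (3 n m)
  then have "n mod m > 0"
    by (metis dvd_eq_mod_eq_0 not_le order_le_less pos_mod_sign zero_less_one order_less_trans)
  with 3 show ?case by auto
next
  case (4 n m)
  then show ?case by auto
qed

declare sp.simps [simp del]

end

theory Submission
  imports Defs
begin

text \<open>For \<open>0 < r < m\<close> the value \<open>sp (m * k + r) m\<close> does not depend on \<open>r\<close>; call it \<open>T k\<close>, so that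
  \<open>T (k + 1) = T k + 2 * sp (k + 1) m\<close>. Summing this over one block of \<open>m\<close> consecutive indices gives
  \<open>T (m * (j + 1) + 1) = T (m * j + 1) + 2 * (m - 1) * T j + 6 * sp (j + 1) m\<close>. As
  \<open>3\<close> divides \<open>m - 1\<close> and \<open>T 1 = 3\<close>, all \<open>T (m * j + 1)\<close> are divisible by \<open>3\<close>.\<close>

lemma sp_less:
  assumes "0 \<le> n" "n < m" "m > 1"
  shows "sp n m = 1"
  using assms by (subst sp.simps) auto

lemma sp_mult:
  assumes "m > 1" "k > 0"
  shows "sp (m * k) m = sp k m"
  using assms by (subst sp.simps) (auto simp: mult_less_0_iff)

lemma sp_mult_add:
  assumes "m > 1" "0 < r" "r < m" "k \<ge> 0"
  shows "sp (m * (k + 1) + r) m = 2 * sp (k + 1) m + sp (m * k + r) m"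
proof -
  have "m * (k + 1) \<ge> m"
    using assms mult_left_mono[of 1 "k + 1" m] by simp
  then have ge: "\<not> m * (k + 1) + r < m" "\<not> m * (k + 1) + r < 0"
    using assms by linarith+
  have mod: "(m * (k + 1) + r) mod m = r"
    using assms by simp
  then have "\<not> m dvd m * (k + 1) + r"
    using assms by (simp add: dvd_eq_mod_eq_0)
  then have "sp (m * (k + 1) + r) m = 2 * sp (m * (k + 1)) m + sp (m * (k + 1) + r - m) m"
    using assms ge mod by (subst sp.simps) (simp only: if_False, simp)
  also have "m * (k + 1) + r - m = m * k + r"
    by (simp add: algebra_simps)
  finally show ?thesis
    using assms by (simp add: sp_mult)
qed

text \<open>In \<open>sp_mult_add\<close> the increment \<open>2 * sp (k + 1) m\<close> is free of
  \<open>r\<close>, and for \<open>k = 0\<close> every residue gives the value 1.\<close>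

lemma sp_mult_add_residue:
  assumes "m > 1" "0 < r" "r < m" "k \<ge> 0"
  shows "sp (m * k + r) m = sp (m * k + 1) m"
  using \<open>k \<ge> 0\<close>
proof (induction k rule: int_ge_induct)
  case base
  show ?case using assms by (simp add: sp_less)
next
  case (step k)
  then show ?case using assms by (simp only: sp_mult_add)
qed

text \<open>Each of the \<open>t\<close> steps adds twice \<open>sp\<close> at an index between two
  consecutive multiples of \<open>m\<close>, hence the same amount.\<close>

lemma sp_within_block:
  assumes "m > 1" "j \<ge> 0" "int t \<le> m - 2"
  shows "sp (m * (m * j + 1 + int t) + 1) m = sp (m * (m * j + 1) + 1) m + 2 * t * sp (m * j + 1) m"
  using assms(3)
proof (induction t)
  case 0
  show ?case by simp
next
  case (Suc t)
  have "sp (m * (m * j + 1 + int t + 1) + 1) m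
      = 2 * sp (m * j + 1 + int t + 1) m + sp (m * (m * j + 1 + int t) + 1) m"
    using assms by (intro sp_mult_add) auto
  \<comment> \<open>The residue here is \<open>int t + 2\<close>, which is at most
    \<open>m - 1\<close> by the bound on \<open>Suc t\<close>.\<close>
  also have "sp (m * j + 1 + int t + 1) m = sp (m * j + 1) m"
    using assms Suc.prems sp_mult_add_residue[of m "int t + 2" j] by (simp add: algebra_simps)
  finally show ?case
    using Suc by (simp add: algebra_simps)
qed

lemma sp_next_block:
  assumes "m > 1" "j \<ge> 0"
  shows "sp (m * (m * (j + 1) + 1) + 1) m
    = sp (m * (m * j + 1) + 1) m + 2 * nat (m - 1) * sp (m * j + 1) m + 6 * sp (j + 1) m"
proof -
  \<comment> \<open>After \<open>m - 2\<close> steps the index is the last one before the multiple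
    \<open>m * (j + 1)\<close>.\<close>
  define t where "t = nat (m - 2)"
  have t: "m * j + 1 + int t = m * (j + 1) - 1" "nat (m - 1) = t + 1"
    using assms by (auto simp: t_def algebra_simps)
  have pos: "m * (j + 1) > 0"
    using assms by simp
  have "sp (m * (m * (j + 1) + 1) + 1) m
      = 2 * sp (m * (j + 1) + 1) m + sp (m * (m * (j + 1)) + 1) m"
    using assms pos by (intro sp_mult_add) auto
  also have "sp (m * (m * (j + 1)) + 1) m
      = 2 * sp (j + 1) m + sp (m * (m * (j + 1) - 1) + 1) m"
    using assms pos sp_mult_add[of m 1 "m * (j + 1) - 1"] sp_mult[of m "j + 1"] by simp
  also have "sp (m * (m * (j + 1) - 1) + 1) m
      = sp (m * (m * j + 1) + 1) m + 2 * t * sp (m * j + 1) m"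
    using sp_within_block[of m j t] assms unfolding t by (simp add: t_def)
  \<comment> \<open>Doubled, this gives \<open>4 * sp (j + 1) m\<close>; the step onto the multiple
    of \<open>m\<close> gave 2 more, hence the coefficient 6.\<close>
  also have "sp (m * (j + 1) + 1) m = 2 * sp (j + 1) m + sp (m * j + 1) m"
    using assms by (intro sp_mult_add) auto
  finally show ?thesis
    unfolding t by (simp add: algebra_simps)
qed

lemma three_dvd_sp_block:
  assumes "m > 1" "[m = 1] (mod 3)" "j \<ge> 0"
  shows "3 dvd sp (m * (m * j + 1) + 1) m"
  using \<open>j \<ge> 0\<close>
proof (induction j rule: int_ge_induct)
  case base
  show ?case
    using assms sp_mult_add[of m 1 0] by (simp add: sp_less)
next
  case (step j)
  have "3 dvd m - 1"
    using assms by (simp add: cong_iff_dvd_diff)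
  then have "3 dvd nat (m - 1)"
    using assms by (simp add: nat_dvd_iff dvd_nat_abs_iff flip: int_dvd_int_iff)
  then show ?case
    using step assms by (simp add: sp_next_block)
qed

theorem theorem4p3:
  fixes m r j :: int
  assumes "m \<ge> 4" and "[m = 1] (mod 3)"
    and "1 \<le> r" and "r < m"
    and "j \<ge> 0"
  shows "[sp (m\<^sup>2 * j + m + r) m = 0] (mod 3)"
proof -
  have "m\<^sup>2 * j + m + r = m * (m * j + 1) + r"
    by (simp add: power2_eq_square algebra_simps)
  then have "sp (m\<^sup>2 * j + m + r) m = sp (m * (m * j + 1) + 1) m"
    using assms sp_mult_add_residue[of m r "m * j + 1"] by simp
  then show ?thesis
    using three_dvd_sp_block[of m j] assms by (simp add: cong_0_iff)
qed

end
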